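(* For all $n\ge 7$, $$A_n = 3A_{n-1} - 3A_{n-2} + 2A_{n-3} - 2A_{n-4} + A_{n-5},$$ and the initial values are $A_1=1$, $A_2=2$, $A_3=5$, $A_4=8$, $A_5=12$, $A_6=18$.
   Context: $S_n$ is the set of permutations of $\{1,\dots,n\}$ written in one-line notation. A permutation $\pi\in S_n$ avoids $132$ if there are no indices $i<j<k$ with $\pi_i<\pi_k<\pi_j$. For $n\ge 1$, $A_n$ denotes the number of $\pi\in S_n$ that avoid $132$ and satisfy $|\pi_{i+1}-\pi_i|\le 2$ for all $1\le i<n$. *)

theory Defs
  imports Complex_Main "HOL-Combinatorics.Permutations"
begin

(* A permutation of {1..n} is a function p with "p permutes {1..n}"; its one-line
   notation is p 1, ..., p n, and p is the identity outside {1..n}. *)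

definition avoids_132 :: "nat \<Rightarrow> (nat \<Rightarrow> nat) \<Rightarrow> bool" where
  "avoids_132 n p \<longleftrightarrow>
     \<not> (\<exists>i\<in>{1..n}. \<exists>j\<in>{1..n}. \<exists>k\<in>{1..n}. i < j \<and> j < k \<and> p i < p k \<and> p k < p j)"

definition adjacent_diffs_le_2 :: "nat \<Rightarrow> (nat \<Rightarrow> nat) \<Rightarrow> bool" where
  "adjacent_diffs_le_2 n p \<longleftrightarrow>
     (\<forall>i. 1 \<le> i \<and> i < n \<longrightarrow> \<bar>int (p (i + 1)) - int (p i)\<bar> \<le> 2)"

definition A :: "nat \<Rightarrow> nat" where
  "A n = card {p. p permutes {1..n} \<and> avoids_132 n p \<and> adjacent_diffs_le_2 n p}"

end

theory Submission
  imports Defs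
begin

text \<open>
  Write a permutation counted by \<open>A n\<close> in one-line notation as \<open>s n t\<close>. Avoiding 132 forces every
  entry of \<open>s\<close> above every entry of \<open>t\<close>, and if \<open>t\<close> is nonempty its first entry is at least \<open>n - 2\<close>.
  Hence \<open>t\<close> is empty, or \<open>s\<close> is empty, or \<open>s\<close> is the single entry \<open>n - 1\<close>. Refining this by the
  position of first and last entries gives \<open>A n = (n - 1) + b n + b (n - 2)\<close>, where \<open>b n\<close> counts
  the permutations that start with \<open>n\<close> and \<open>b n = b (n - 1) + b (n - 3) + 1\<close>. The characteristic
  polynomial of the recurrence is \<open>(x - 1)^2 (x^3 - x^2 - 1)\<close>.
\<close>

section \<open>One-line notation as lists\<close>

fun avoids132_list :: "nat list \<Rightarrow> bool" where
  "avoids132_list [] \<longleftrightarrow> True"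
| "avoids132_list (x # xs) \<longleftrightarrow> avoids132_list xs \<and> sorted_wrt (\<lambda>b c. \<not> (x < c \<and> c < b)) xs"

abbreviation close :: "nat \<Rightarrow> nat \<Rightarrow> bool" where
  "close a b \<equiv> \<bar>int b - int a\<bar> \<le> 2"

text \<open>Lists replace functions so that cutting at the maximum and attaching an entry at either
  end need no reindexing.\<close>

definition good_lists :: "nat \<Rightarrow> nat list set" where
  "good_lists n =
     {xs. distinct xs \<and> set xs = {1..n} \<and> avoids132_list xs \<and> successively close xs}"

text \<open>Bridge between the recursive predicate, suited to induction along the list, and the
  quantification over positions in \<open>avoids_132\<close>. The recursion treats the head as the
  smallest entry of a possible pattern.\<close>

lemma avoids132_list_iff_nth:
  "avoids132_list xs \<longleftrightarrow>
     (\<forall>i j k. i < j \<longrightarrow> j < k \<longrightarrow> k < length xs \<longrightarrow> \<not> (xs ! i < xs ! k \<and> xs ! k < xs ! j))"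
proof (induction xs)
  case (Cons x xs)
  show ?case (is "_ \<longleftrightarrow> ?R")
  proof
    assume L: "avoids132_list (x # xs)"
    show ?R
    proof (intro allI impI)
      fix i j k
      assume ijk: "i < j" "j < k" "k < length (x # xs)"
      then obtain j' k' where jk: "j = Suc j'" "k = Suc k'"
        by (metis less_nat_zero_code not0_implies_Suc)
      show "\<not> ((x # xs) ! i < (x # xs) ! k \<and> (x # xs) ! k < (x # xs) ! j)"
      proof (cases i)
        case 0
        then show ?thesis
          using L ijk jk by (simp add: sorted_wrt_iff_nth_less)
      next
        case (Suc i')
        then show ?thesis
          using L ijk jk Cons.IH by simp
      qed
    qed
  next
    assume R: ?R
    have "\<not> (xs ! i < xs ! k \<and> xs ! k < xs ! j)" if "i < j" "j < k" "k < length xs" for i j k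
      using R[rule_format, of "Suc i" "Suc j" "Suc k"] that by simp
    moreover have "\<not> (x < xs ! k \<and> xs ! k < xs ! j)" if "j < k" "k < length xs" for j k
      using R[rule_format, of 0 "Suc j" "Suc k"] that by simp
    ultimately show "avoids132_list (x # xs)"
      using Cons.IH by (simp add: sorted_wrt_iff_nth_less)
  qed
qed simp

lemma one_line_in_good_lists_iff:
  assumes "p permutes {1..n}"
  shows "map p [1..<Suc n] \<in> good_lists n \<longleftrightarrow> avoids_132 n p \<and> adjacent_diffs_le_2 n p"
proof -
  let ?xs = "map p [1..<Suc n]"
  have "distinct ?xs"
    using permutes_inj_on[OF assms] by (simp add: distinct_map del: upt_Suc)
  moreover have "set ?xs = {1..n}"
    using permutes_image[OF assms] by (simp add: atLeastLessThanSuc_atLeastAtMost del: upt_Suc)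
  moreover have "avoids132_list ?xs \<longleftrightarrow> avoids_132 n p"
  proof
    assume L: "avoids132_list ?xs"
    show "avoids_132 n p"
      unfolding avoids_132_def
    proof clarify
      fix i j k
      assume "i \<in> {1..n}" "j \<in> {1..n}" "k \<in> {1..n}" "i < j" "j < k" "p i < p k" "p k < p j"
      moreover from this have "k - 1 < n"
        by auto
      ultimately show False
        \<comment> \<open>List positions start at 0 and permutation arguments at 1, hence the
          shift.\<close>
        using L[unfolded avoids132_list_iff_nth, rule_format, of "i - 1" "j - 1" "k - 1"]
        by (simp add: diff_less_mono del: upt_Suc)
    qed
  next
    assume R: "avoids_132 n p"
    show "avoids132_list ?xs"
      unfolding avoids132_list_iff_nth
    proof (intro allI impI)
      fix i j k
      assume ijk: "i < j" "j < k" "k < length ?xs"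
      then have "Suc i \<in> {1..n}" "Suc j \<in> {1..n}" "Suc k \<in> {1..n}"
        by (auto simp del: upt_Suc)
      then have "\<not> (p (Suc i) < p (Suc k) \<and> p (Suc k) < p (Suc j))"
        using R ijk unfolding avoids_132_def by (meson Suc_less_eq)
      then show "\<not> (?xs ! i < ?xs ! k \<and> ?xs ! k < ?xs ! j)"
        using ijk by (simp del: upt_Suc)
    qed
  qed
  moreover have "successively close ?xs \<longleftrightarrow> adjacent_diffs_le_2 n p"
  proof
    assume L: "successively close ?xs"
    show "adjacent_diffs_le_2 n p"
      unfolding adjacent_diffs_le_2_def
    proof (intro allI impI)
      fix i
      assume "1 \<le> i \<and> i < n"
      then show "\<bar>int (p (i + 1)) - int (p i)\<bar> \<le> 2"
        using L[unfolded successively_conv_nth, rule_format, of "i - 1"]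
        by (simp add: less_imp_diff_less del: upt_Suc)
    qed
  next
    assume "adjacent_diffs_le_2 n p"
    then show "successively close ?xs"
      by (auto simp: successively_conv_nth adjacent_diffs_le_2_def simp del: upt_Suc)
  qed
  ultimately show ?thesis
    by (simp add: good_lists_def del: upt_Suc)
qed

text \<open>Taking one-line notation is a bijection. It is injective because two permutations of
  \<open>{1..n}\<close> already agree outside that interval, where both are the identity.\<close>

lemma A_eq_card_good_lists: "A n = card (good_lists n)"
proof -
  let ?P = "{p. p permutes {1..n} \<and> avoids_132 n p \<and> adjacent_diffs_le_2 n p}"
  let ?f = "\<lambda>p. map p [1..<Suc n]"
  have "inj_on ?f ?P"
  proof (rule inj_onI, rule ext)
    fix p q x
    assume p: "p \<in> ?P" and q: "q \<in> ?P" and eq: "?f p = ?f q"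
    show "p x = q x"
    proof (cases "x \<in> {1..n}")
      case True
      then show ?thesis
        using eq by (simp add: map_eq_conv del: upt_Suc)
    next
      case False
      then show ?thesis
        using p q by (simp add: permutes_def)
    qed
  qed
  moreover have "?f ` ?P = good_lists n"
  proof
    show "?f ` ?P \<subseteq> good_lists n"
      using one_line_in_good_lists_iff by blast
    show "good_lists n \<subseteq> ?f ` ?P"
    proof
      fix xs
      assume xs: "xs \<in> good_lists n"
      then have len: "length xs = n" and d: "distinct xs" and s: "set xs = {1..n}"
        using distinct_card[of xs] by (auto simp: good_lists_def)
      \<comment> \<open>The identity outside \<open>{1..n}\<close> is what \<open>permutes\<close>
        demands there.\<close>
      define p where "p i = (if i \<in> {1..n} then xs ! (i - 1) else i)" for i
      have f: "?f p = xs"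
        using len by (auto simp: p_def intro!: nth_equalityI simp del: upt_Suc)
      have "p ` {1..n} = set (?f p)"
        by (simp add: atLeastLessThanSuc_atLeastAtMost del: upt_Suc)
      then have "p ` {1..n} = {1..n}"
        by (simp only: f s)
      \<comment> \<open>A map from a finite set onto itself is injective.\<close>
      then have "bij_betw p {1..n} {1..n}"
        by (simp add: bij_betw_def eq_card_imp_inj_on)
      then have "p permutes {1..n}"
        by (rule bij_imp_permutes) (auto simp: p_def)
      then show "xs \<in> ?f ` ?P"
        using f xs one_line_in_good_lists_iff by blast
    qed
  qed
  ultimately show ?thesis
    unfolding A_def by (metis card_image)
qed

lemma finite_good_lists: "finite (good_lists n)"
proof (rule finite_subset)
  show "good_lists n \<subseteq> {xs. set xs \<subseteq> {1..n} \<and> length xs = n}"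
    using distinct_card by (fastforce simp: good_lists_def)
  show "finite {xs. set xs \<subseteq> {1..n} \<and> length xs = n}"
    by (rule finite_lists_length_eq) simp
qed

section \<open>Avoidance under concatenation, and splitting at the maximum\<close>

lemma avoids132_list_appendD:
  assumes "avoids132_list (s @ t)"
  shows "avoids132_list s" "avoids132_list t"
  using assms by (induction s) (auto simp: sorted_wrt_append)

text \<open>If \<open>a < c\<close>, then \<open>a\<close>, \<open>m\<close>, \<open>c\<close> would
  form a 132 pattern.\<close>

lemma avoids132_list_middle:
  assumes "avoids132_list (s @ m # t)" "a \<in> set s" "c \<in> set t" "c < m"
  shows "c \<le> a"
  using assms by (induction s) (auto simp: sorted_wrt_append not_less)

text \<open>In a pattern using the last position, that entry is the middle value, so a maximum
  placed there creates no pattern.\<close>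

lemma avoids132_list_snoc_max:
  assumes "\<forall>x\<in>set s. x < m"
  shows "avoids132_list (s @ [m]) \<longleftrightarrow> avoids132_list s"
  using assms by (induction s) (auto simp: sorted_wrt_append)

text \<open>In a pattern using the first position, that entry is the smallest value, so a maximum
  placed there creates no pattern.\<close>

lemma avoids132_list_Cons_max:
  assumes "\<forall>x\<in>set t. x < m"
  shows "avoids132_list (m # t) \<longleftrightarrow> avoids132_list t"
  using assms by (auto simp: sorted_wrt_iff_nth_less dest!: nth_mem)

lemma sorted_wrt_if_all_le:
  "\<forall>c\<in>set t. c \<le> m \<Longrightarrow> sorted_wrt (\<lambda>b c. m < c \<longrightarrow> \<not> c < b) t" for m :: nat
  by (induction t) auto

lemma good_lists_ne: "xs \<in> good_lists (Suc n) \<Longrightarrow> xs \<noteq> []"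
  by (auto simp: good_lists_def)

lemma good_lists_bound:
  assumes "xs \<in> good_lists (Suc n)"
  shows "hd xs \<le> Suc n" "last xs \<le> Suc n"
proof -
  have "set xs = {1..Suc n}" "xs \<noteq> []"
    using assms good_lists_ne by (auto simp: good_lists_def)
  then show "hd xs \<le> Suc n" "last xs \<le> Suc n"
    using hd_in_set last_in_set by fastforce+
qed

text \<open>The three sets correspond to nothing after the maximum \<open>n + 2\<close>, nothing
  before it, and only \<open>n + 1\<close> before it. The bounds on \<open>last s\<close> and
  \<open>hd t\<close> express closeness to the maximum; in the third case \<open>n\<close> is the
  only entry of \<open>t\<close> close enough to follow it.\<close>

lemma good_lists_decomp:
  assumes "n \<ge> 1"
  shows "good_lists (n + 2) =
      (\<lambda>s. s @ [n + 2]) ` {s \<in> good_lists (n + 1). last s \<ge> n} \<union>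
      (\<lambda>t. (n + 2) # t) ` {t \<in> good_lists (n + 1). hd t \<ge> n} \<union>
      (\<lambda>t. (n + 1) # (n + 2) # t) ` {t \<in> good_lists n. hd t = n}"
    (is "_ = ?S \<union> ?C \<union> ?D")
proof
  show "good_lists (n + 2) \<subseteq> ?S \<union> ?C \<union> ?D"
  proof
    fix xs
    assume "xs \<in> good_lists (n + 2)"
    then have d: "distinct xs" and set: "set xs = {1..n + 2}" and av: "avoids132_list xs"
      and cl: "successively close xs"
      by (auto simp: good_lists_def)
    from set have "n + 2 \<in> set xs"
      by simp
    then obtain s t where xs: "xs = s @ (n + 2) # t"
      by (meson split_list)
    have un: "set s \<union> set t = {1..n + 1}"
    proof -
      have "set s \<union> set t = set xs - {n + 2}"
        using d by (auto simp: xs)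
      also have "\<dots> = {1..n + 1}"
        unfolding set by auto
      finally show ?thesis .
    qed
    have av_s: "avoids132_list s" and av_t: "avoids132_list t"
      using av avoids132_list_appendD[of s "(n + 2) # t"] by (auto simp: xs)
    have cl_s: "successively close s" and cl_t: "successively close t"
      using cl by (auto simp: xs successively_append_iff successively_Cons)
    show "xs \<in> ?S \<union> ?C \<union> ?D"
    proof (cases "t = []")
      case True
      then have s_ne: "s \<noteq> []"
        using un by auto
      then have "last s \<ge> n"
        using cl by (auto simp: xs successively_append_iff)
      moreover have "s \<in> good_lists (n + 1)"
        using True un d av_s cl_s by (auto simp: good_lists_def xs)
      ultimately show ?thesis
        using True xs by auto
    next
      case False
      then have hd_t: "hd t \<ge> n" "hd t \<in> set t" "hd t \<le> n + 1"
        using cl un by (auto simp: xs successively_append_iff successively_Cons)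
      \<comment> \<open>Avoidance with the maximum in the middle puts \<open>a\<close> above
        \<open>hd t\<close>, while closeness gives \<open>hd t \<ge> n\<close>. This leaves a single
        value for each.\<close>
      have "a = n + 1 \<and> hd t = n" if "a \<in> set s" for a
      proof -
        have "hd t \<le> a"
          using avoids132_list_middle[of s "n + 2" t a "hd t"] av xs that hd_t by simp
        moreover have "hd t \<noteq> a"
          using d xs that hd_t by auto
        moreover have "a \<le> n + 1"
          using un that by auto
        ultimately show ?thesis
          using hd_t by linarith
      qed
      then consider "s = []" | "set s = {n + 1}" "hd t = n"
        by (cases s) auto
      then show ?thesis
      proof cases
        case 1
        then have "t \<in> good_lists (n + 1)"
          using un d av_t cl_t by (auto simp: good_lists_def xs)
        then show ?thesis
          using 1 hd_t xs by auto
      next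
        case 2
        moreover have "distinct s"
          using d xs by simp
        ultimately have s: "s = [n + 1]"
          by (cases s) (auto simp: subset_singleton_iff)
        have "set t = (set s \<union> set t) - {n + 1}"
          using d by (auto simp: xs s)
        also have "\<dots> = {1..n}"
          unfolding un by auto
        finally have "set t = {1..n}" .
        then have "t \<in> good_lists n"
          using d av_t cl_t by (auto simp: good_lists_def xs)
        then show ?thesis
          using s 2 xs by auto
      qed
    qed
  qed
  have iv: "{1..n + 2} = insert (n + 2) {1..n + 1}" "{1..n + 1} = insert (n + 1) {1..n}"
    by auto
  have S: "s @ [n + 2] \<in> good_lists (n + 2)" if "s \<in> good_lists (n + 1)" "last s \<ge> n" for s
  proof -
    have s: "set s = {1..n + 1}" "distinct s" "avoids132_list s" "successively close s"
      using that by (auto simp: good_lists_def)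
    have "set (s @ [n + 2]) = {1..n + 2}"
      unfolding iv(1) by (simp add: s(1))
    moreover have "distinct (s @ [n + 2])"
      using s by simp
    moreover have "avoids132_list (s @ [n + 2])"
      using s by (subst avoids132_list_snoc_max) auto
    moreover have "last s \<le> n + 1"
      using good_lists_bound that by simp
    then have "successively close (s @ [n + 2])"
      using s(4) that(2) by (simp add: successively_append_iff)
    ultimately show ?thesis
      unfolding good_lists_def by blast
  qed
  have max_Cons: "distinct ((n + 2) # t) \<and> avoids132_list ((n + 2) # t)"
    if "set t \<subseteq> {1..n + 1}" "distinct t" "avoids132_list t" for t
  proof -
    have "\<forall>x\<in>set t. x < n + 2"
      using that(1) by (auto dest!: subsetD)
    then show ?thesis
      using that avoids132_list_Cons_max by auto
  qed
  have C: "(n + 2) # t \<in> good_lists (n + 2)" if "t \<in> good_lists (n + 1)" "hd t \<ge> n" for t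
  proof -
    have t: "set t = {1..n + 1}" "distinct t" "avoids132_list t" "successively close t"
      using that by (auto simp: good_lists_def)
    have "set ((n + 2) # t) = {1..n + 2}"
      unfolding iv(1) by (simp add: t(1))
    moreover have "distinct ((n + 2) # t) \<and> avoids132_list ((n + 2) # t)"
      using t by (intro max_Cons) simp_all
    moreover have "hd t \<le> n + 1"
      using good_lists_bound that by simp
    then have "successively close ((n + 2) # t)"
      using t(4) that(2) by (simp add: successively_Cons)
    ultimately show ?thesis
      unfolding good_lists_def by blast
  qed
  have D: "(n + 1) # (n + 2) # t \<in> good_lists (n + 2)" if "t \<in> good_lists n" "hd t = n" for t
  proof -
    have t: "set t = {1..n}" "distinct t" "avoids132_list t" "successively close t"
      using that by (auto simp: good_lists_def)
    have "set ((n + 1) # (n + 2) # t) = {1..n + 2}"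
      unfolding iv by (simp add: t(1) insert_commute)
    moreover have Cons: "distinct ((n + 2) # t) \<and> avoids132_list ((n + 2) # t)"
      using t by (intro max_Cons) simp_all
    moreover have "distinct ((n + 1) # (n + 2) # t)"
      using t by simp
    \<comment> \<open>A pattern starting at \<open>n + 1\<close> needs two larger entries, and only
      \<open>n + 2\<close> is larger.\<close>
    moreover have "sorted_wrt (\<lambda>b c. \<not> (n + 1 < c \<and> c < b)) ((n + 2) # t)"
      using t(1) by (simp add: sorted_wrt_if_all_le)
    then have "avoids132_list ((n + 1) # (n + 2) # t)"
      using Cons by (simp only: avoids132_list.simps)
    moreover have "successively close ((n + 1) # (n + 2) # t)"
      using t(4) that(2) by (simp add: successively_Cons)
    ultimately show ?thesis
      unfolding good_lists_def by blast
  qed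
  show "?S \<union> ?C \<union> ?D \<subseteq> good_lists (n + 2)"
    using S C D by blast
qed

section \<open>Classes by first and last entry, and their recurrences\<close>

definition start_max :: "nat \<Rightarrow> nat list set" where
  "start_max n = {xs \<in> good_lists n. hd xs = n}"

text \<open>For positive \<open>n\<close>, this class and \<open>start_max n\<close> together hold
  the lists that remain close when a new maximum is put in front. The form \<open>hd xs + 1\<close>
  avoids truncated subtraction.\<close>

definition start_second :: "nat \<Rightarrow> nat list set" where
  "start_second n = {xs \<in> good_lists n. hd xs + 1 = n}"

text \<open>For positive \<open>n\<close>, these are the lists that remain close when a new maximum
  \<open>n + 1\<close> is appended.\<close>

definition end_high :: "nat \<Rightarrow> nat list set" where
  "end_high n = {xs \<in> good_lists n. last xs + 1 \<ge> n}"

definition start_high_end_max :: "nat \<Rightarrow> nat list set" where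
  "start_high_end_max n = {xs \<in> good_lists n. hd xs + 1 \<ge> n \<and> last xs = n}"

definition start_max_end_high :: "nat \<Rightarrow> nat list set" where
  "start_max_end_high n = {xs \<in> good_lists n. hd xs = n \<and> last xs + 1 \<ge> n}"

lemmas class_defs =
  start_max_def start_second_def end_high_def start_high_end_max_def start_max_end_high_def

lemma finite_start_classes [simp]: "finite (start_max n)" "finite (start_second n)"
  using finite_good_lists by (auto simp: class_defs)

lemma good_lists_1: "good_lists 1 = {[1]}"
proof -
  have "xs = [1]" if "distinct xs" "set xs = {1}" for xs :: "nat list"
    using that by (cases xs) (auto simp: subset_singleton_iff)
  then show ?thesis
    by (auto simp: good_lists_def)
qed

lemma good_lists_2: "good_lists 2 = {[1, 2], [2, 1]}"
proof -
  have e: "{1..2} = {1, 2::nat}"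
    by auto
  have "xs = [1, 2] \<or> xs = [2, 1]" if "distinct xs" "set xs = {1, 2}" for xs :: "nat list"
  proof -
    have "length xs = 2"
      using distinct_card[OF that(1)] that(2) by simp
    then obtain a b where "xs = [a, b]"
      by (auto simp: numeral_2_eq_2 length_Suc_conv)
    with that show ?thesis
      by (auto simp: doubleton_eq_iff)
  qed
  then show ?thesis
    unfolding good_lists_def e by auto
qed

text \<open>The three attaching maps are injective with disjoint images. With \<open>P\<close>
  arbitrary, each class recurrence below amounts to reading the class condition on the three
  pieces.\<close>

lemma card_good_lists_filter:
  assumes "n \<ge> 1"
  shows "card {xs \<in> good_lists (n + 2). P xs} =
      card {s \<in> good_lists (n + 1). last s \<ge> n \<and> P (s @ [n + 2])} +
      card {t \<in> good_lists (n + 1). hd t \<ge> n \<and> P ((n + 2) # t)} +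
      card {t \<in> good_lists n. hd t = n \<and> P ((n + 1) # (n + 2) # t)}"
    (is "_ = card ?S + card ?C + card ?D")
proof -
  let ?s = "\<lambda>s. s @ [n + 2]" and ?c = "Cons (n + 2)" and ?d = "\<lambda>t. (n + 1) # (n + 2) # t"
  have split: "{xs \<in> good_lists (n + 2). P xs} = ?s ` ?S \<union> (?c ` ?C \<union> ?d ` ?D)"
    unfolding good_lists_decomp[OF assms] by blast
  \<comment> \<open>The entry \<open>n + 1\<close> makes \<open>s\<close> nonempty, so appending
    leaves its first entry in place, and that entry is not \<open>n + 2\<close>.\<close>
  have s_set: "n + 2 \<notin> set s" "n + 1 \<in> set s" if "s \<in> ?S" for s
    using that by (auto simp: good_lists_def)
  have "?s s \<noteq> ?c t" if "s \<in> ?S" for s t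
    using s_set[OF that] by (cases s) auto
  moreover have "?s s \<noteq> ?d t" if "s \<in> ?S" "t \<in> ?D" for s t
  proof
    assume "?s s = ?d t"
    \<comment> \<open>Since \<open>t\<close> is nonempty, the final entry of the right side belongs
      to \<open>t\<close>, and the \<open>n + 2\<close> in second position would have to lie in
      \<open>s\<close>.\<close>
    moreover have "t \<noteq> []"
      using that assms by (auto simp: good_lists_def)
    ultimately have "s = (n + 1) # (n + 2) # butlast t"
      by (metis butlast.simps(2) butlast_snoc list.discI)
    then show False
      using s_set[OF that(1)] by simp
  qed
  ultimately have disj: "?s ` ?S \<inter> (?c ` ?C \<union> ?d ` ?D) = {}" "?c ` ?C \<inter> ?d ` ?D = {}"
    by (blast, auto)
  have "finite ?S" "finite ?C" "finite ?D"
    using finite_good_lists by auto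
  moreover have "card (?s ` ?S) = card ?S" "card (?c ` ?C) = card ?C" "card (?d ` ?D) = card ?D"
    by (auto intro!: card_image inj_onI)
  ultimately show ?thesis
    unfolding split using disj by (simp add: card_Un_disjoint)
qed

lemma hd_good_lists_append: "s \<in> good_lists (Suc n) \<Longrightarrow> hd (s @ t) = hd s"
  using good_lists_ne by simp

text \<open>Only putting the maximum in front makes it the first entry; the rest then starts with
  one of its two largest values.\<close>

lemma card_start_max:
  assumes "n \<ge> 1"
  shows "card (start_max (n + 2)) = card (start_max (n + 1)) + card (start_second (n + 1))"
proof -
  let ?P = "\<lambda>xs. hd xs = n + 2"
  have S: "{s \<in> good_lists (n + 1). last s \<ge> n \<and> ?P (s @ [n + 2])} = {}"
    by (auto simp: hd_good_lists_append dest: good_lists_bound)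
  have C: "{t \<in> good_lists (n + 1). hd t \<ge> n \<and> ?P ((n + 2) # t)} =
      start_max (n + 1) \<union> start_second (n + 1)"
    by (auto simp: class_defs dest: good_lists_bound)
  have D: "{t \<in> good_lists n. hd t = n \<and> ?P ((n + 1) # (n + 2) # t)} = {}"
    by auto
  have "start_max (n + 1) \<inter> start_second (n + 1) = {}"
    by (auto simp: class_defs)
  then show ?thesis
    using card_good_lists_filter[OF assms, of ?P, unfolded S C D]
    by (simp add: start_max_def[of "n + 2", simplified] card_Un_disjoint)
qed

text \<open>A first entry \<open>n + 1\<close> arises by appending the maximum to a list that
  already starts with \<open>n + 1\<close>, or from the piece that begins with \<open>n + 1\<close>,
  \<open>n + 2\<close>.\<close>

lemma card_start_second:
  assumes "n \<ge> 1"
  shows "card (start_second (n + 2)) = card (start_max_end_high (n + 1)) + card (start_max n)"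
proof -
  let ?P = "\<lambda>xs. hd xs + 1 = n + 2"
  have S: "{s \<in> good_lists (n + 1). last s \<ge> n \<and> ?P (s @ [n + 2])} = start_max_end_high (n + 1)"
    by (auto simp: class_defs hd_good_lists_append)
  have C: "{t \<in> good_lists (n + 1). hd t \<ge> n \<and> ?P ((n + 2) # t)} = {}"
    by auto
  have D: "{t \<in> good_lists n. hd t = n \<and> ?P ((n + 1) # (n + 2) # t)} = start_max n"
    by (auto simp: class_defs)
  show ?thesis
    using card_good_lists_filter[OF assms, of ?P, unfolded S C D]
    by (simp add: start_second_def[of "n + 2", simplified])
qed

text \<open>Every appended maximum qualifies. With the maximum in front, the last entry must be
  \<open>n + 1\<close>; the third piece ends in an entry at most \<open>n\<close>, which is too
  small.\<close>

lemma card_end_high: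
  assumes "n \<ge> 1"
  shows "card (end_high (n + 2)) = card (end_high (n + 1)) + card (start_high_end_max (n + 1))"
proof -
  let ?P = "\<lambda>xs. last xs + 1 \<ge> n + 2"
  have S: "{s \<in> good_lists (n + 1). last s \<ge> n \<and> ?P (s @ [n + 2])} = end_high (n + 1)"
    by (auto simp: class_defs)
  have C: "{t \<in> good_lists (n + 1). hd t \<ge> n \<and> ?P ((n + 2) # t)} = start_high_end_max (n + 1)"
    by (auto simp: class_defs dest: good_lists_ne good_lists_bound)
  have D: "{t \<in> good_lists n. hd t = n \<and> ?P ((n + 1) # (n + 2) # t)} = {}"
    using assms by (cases n) (auto dest: good_lists_ne good_lists_bound)
  show ?thesis
    using card_good_lists_filter[OF assms, of ?P, unfolded S C D]
    by (simp add: end_high_def[of "n + 2", simplified])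
qed

text \<open>The maximum must be appended here, and put in front in
  \<open>card_start_max_end_high\<close>. Each class thus comes from the other one size lower, by
  alternating the two operations.\<close>

lemma card_start_high_end_max:
  assumes "n \<ge> 1"
  shows "card (start_high_end_max (n + 2)) = card (start_max_end_high (n + 1))"
proof -
  let ?P = "\<lambda>xs. hd xs + 1 \<ge> n + 2 \<and> last xs = n + 2"
  have S: "{s \<in> good_lists (n + 1). last s \<ge> n \<and> ?P (s @ [n + 2])} = start_max_end_high (n + 1)"
    by (auto simp: class_defs hd_good_lists_append intro: le_antisym dest: good_lists_bound)
  have C: "{t \<in> good_lists (n + 1). hd t \<ge> n \<and> ?P ((n + 2) # t)} = {}"
    by (auto dest: good_lists_ne good_lists_bound)
  have D: "{t \<in> good_lists n. hd t = n \<and> ?P ((n + 1) # (n + 2) # t)} = {}"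
    using assms by (cases n) (auto dest: good_lists_ne good_lists_bound)
  show ?thesis
    using card_good_lists_filter[OF assms, of ?P, unfolded S C D]
    by (simp add: start_high_end_max_def[of "n + 2", simplified])
qed

lemma card_start_max_end_high:
  assumes "n \<ge> 1"
  shows "card (start_max_end_high (n + 2)) = card (start_high_end_max (n + 1))"
proof -
  let ?P = "\<lambda>xs. hd xs = n + 2 \<and> last xs + 1 \<ge> n + 2"
  have S: "{s \<in> good_lists (n + 1). last s \<ge> n \<and> ?P (s @ [n + 2])} = {}"
    by (auto simp: hd_good_lists_append dest: good_lists_bound)
  have C: "{t \<in> good_lists (n + 1). hd t \<ge> n \<and> ?P ((n + 2) # t)} = start_high_end_max (n + 1)"
    by (auto simp: class_defs dest: good_lists_ne good_lists_bound)
  have D: "{t \<in> good_lists n. hd t = n \<and> ?P ((n + 1) # (n + 2) # t)} = {}"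
    by auto
  show ?thesis
    using card_good_lists_filter[OF assms, of ?P, unfolded S C D]
    by (simp add: start_max_end_high_def[of "n + 2", simplified])
qed

lemma A_decomp:
  assumes "n \<ge> 1"
  shows "A (n + 2) = card (end_high (n + 1)) + card (start_max (n + 2)) + card (start_max n)"
proof -
  have "{t \<in> good_lists (n + 1). hd t \<ge> n} = start_max (n + 1) \<union> start_second (n + 1)"
    by (auto simp: class_defs dest: good_lists_bound)
  moreover have "start_max (n + 1) \<inter> start_second (n + 1) = {}"
    by (auto simp: class_defs)
  \<comment> \<open>Lists to which a maximum may be prefixed correspond to the lists of
    \<open>start_max (n + 2)\<close>, so their number is expressed by that class.\<close>
  ultimately have "card {t \<in> good_lists (n + 1). hd t \<ge> n} = card (start_max (n + 2))"
    by (simp only: card_start_max[OF assms] card_Un_disjoint finite_start_classes)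
  then show ?thesis
    using card_good_lists_filter[OF assms, of "\<lambda>_. True"]
    by (simp add: A_eq_card_good_lists end_high_def start_max_def[of n])
qed

section \<open>Initial values and solving the class recurrences\<close>

lemma class_1:
  "start_max 1 = {[1]}" "end_high 1 = {[1]}" "start_high_end_max 1 = {[1]}"
  "start_max_end_high 1 = {[1]}"
  unfolding class_defs good_lists_1 by auto

lemma class_2:
  "start_max 2 = {[2, 1]}" "start_second 2 = {[1, 2]}" "end_high 2 = {[1, 2], [2, 1]}"
  "start_high_end_max 2 = {[1, 2]}" "start_max_end_high 2 = {[2, 1]}"
  unfolding class_defs good_lists_2 by auto

text \<open>The two counts refer to each other in their recurrences, hence the joint
  induction.\<close>

lemma card_start_end_classes:
  "card (start_high_end_max (n + 1)) = 1 \<and> card (start_max_end_high (n + 1)) = 1"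
proof (induction n)
  case 0
  then show ?case
    using class_1 by simp
next
  case (Suc n)
  show ?case
  \<comment> \<open>The recurrences begin at size 3, so size 2 is a second base case.\<close>
  proof (cases n)
    case 0
    then show ?thesis
      using class_2 by (simp add: numeral_2_eq_2)
  next
    case (Suc m)
    then show ?thesis
      using Suc.IH card_start_high_end_max[of n] card_start_max_end_high[of n] by simp
  qed
qed

lemma card_end_high_eq: "card (end_high (n + 1)) = n + 1"
proof (induction n)
  case 0
  then show ?case
    using class_1 by simp
next
  case (Suc n)
  show ?case
  proof (cases n)
    case 0
    then show ?thesis
      using class_2 by (simp add: numeral_2_eq_2)
  next
    case (Suc m)
    then show ?thesis
      using Suc.IH card_end_high[of n] card_start_end_classes[of n] by simp
  qed
qed

text \<open>Substitute \<open>card_start_second\<close> into \<open>card_start_max\<close>; the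
  summand 1 is the single list in \<open>start_max_end_high (n + 1)\<close>.\<close>

lemma card_start_max_rec:
  assumes "n \<ge> 1"
  shows "card (start_max (n + 3)) = card (start_max (n + 2)) + card (start_max n) + 1"
  using card_start_max[of "n + 1"] card_start_second[OF assms] card_start_end_classes[of n]
  by (simp add: numeral_eq_Suc)

lemma A_eq_start_max:
  assumes "n \<ge> 1"
  shows "A (n + 2) = n + 1 + card (start_max (n + 2)) + card (start_max n)"
  using A_decomp[OF assms] card_end_high_eq[of n] by simp

section \<open>Assembling the linear recurrence\<close>

theorem mainTheorem7:
  shows "(\<forall>n\<ge>7. int (A n) = 3 * int (A (n - 1)) - 3 * int (A (n - 2)) + 2 * int (A (n - 3))
                     - 2 * int (A (n - 4)) + int (A (n - 5)))
       \<and> A 1 = 1 \<and> A 2 = 2 \<and> A 3 = 5 \<and> A 4 = 8 \<and> A 5 = 12 \<and> A 6 = 18"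
proof -
  define b where "b n = card (start_max n)" for n
  have b_rec: "b (n + 3) = b (n + 2) + b n + 1" if "n \<ge> 1" for n
    unfolding b_def by (rule card_start_max_rec[OF that])
  have A_b: "A (n + 2) = n + 1 + b (n + 2) + b n" if "n \<ge> 1" for n
    unfolding b_def by (rule A_eq_start_max[OF that])
  have A1: "A 1 = 1" and A2: "A 2 = 2"
    by (simp_all only: A_eq_card_good_lists good_lists_1 good_lists_2) simp_all
  have b1: "b 1 = 1" and b2: "b 2 = 1"
    by (simp_all only: b_def class_1 class_2) simp_all
  \<comment> \<open>The recurrence \<open>b_rec\<close> first yields \<open>b 4\<close>, so this
    value comes from \<open>card_start_max\<close>.\<close>
  have b3: "b 3 = 2"
    using card_start_max[of 1] class_2 by (simp add: b_def numeral_eq_Suc)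
  have b4: "b 4 = 4" and b5: "b 5 = 6" and b6: "b 6 = 9"
    using b_rec[of 1] b_rec[of 2] b_rec[of 3] b1 b2 b3 by (simp_all add: numeral_eq_Suc)
  have A3: "A 3 = 5" and A4: "A 4 = 8" and A5: "A 5 = 12" and A6: "A 6 = 18"
    using A_b[of 1] A_b[of 2] A_b[of 3] A_b[of 4] b1 b2 b3 b4 b5 b6
    by (simp_all add: numeral_eq_Suc)
  have "int (A n) = 3 * int (A (n - 1)) - 3 * int (A (n - 2)) + 2 * int (A (n - 3))
                     - 2 * int (A (n - 4)) + int (A (n - 5))" if "n \<ge> 7" for n
  \<comment> \<open>For \<open>n = 7\<close> the recurrence involves \<open>A 2\<close>, which
    \<open>A_b\<close> does not cover.\<close>
  proof (cases "n = 7")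
    case True
    have "A 7 = 26"
      using A_b[of 5] b_rec[of 4] b4 b5 b6 by simp
    then show ?thesis
      using True A2 A3 A4 A5 A6 by simp
  next
    case False
    define m where "m = n - 7"
    have n: "n = m + 7" and m: "m \<ge> 1"
      using that False by (auto simp: m_def)
    have "b (m + k + 3) = b (m + k + 2) + b (m + k) + 1"
      "A (m + k + 2) = m + k + 1 + b (m + k + 2) + b (m + k)" for k
      using m b_rec[of "m + k"] A_b[of "m + k"] by simp_all
    \<comment> \<open>These instances express \<open>A (m + 2)\<close> up to
      \<open>A (m + 7)\<close> through \<open>m\<close>, \<open>b m\<close>,
      \<open>b (m + 1)\<close> and \<open>b (m + 2)\<close>, leaving a linear identity. The double
      root 1 of the characteristic polynomial cancels the part of \<open>A\<close> linear in
      \<open>m\<close> and the constant in \<open>b_rec\<close>.\<close>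
    from this[of 0] this[of 1] this[of 2] this[of 3] this[of 4] this[of 5] show ?thesis
      by (simp add: n numeral_eq_Suc)
  qed
  then show ?thesis
    using A1 A2 A3 A4 A5 A6 by blast
qed

end
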